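(* Let $f:\mathbb{R}\to\mathbb{R}$ be a smooth, (globally) Lipschitz continuous function, and let $u_0\in L^2(\mathbb{R})$. Let $u^\epsilon$ be the (smooth, rapidly decaying) solution of $$u_t+f(u)_x=\epsilon\,u_{xx}+\delta\,u_{xxx},\quad x\in\mathbb{R},\ t\ge 0,\qquad u(x,0)=u_0^\epsilon(x),\quad x\in\mathbb{R},$$ where $\epsilon>0$, $\delta=\delta(\epsilon)\ge 0$. Then the following estimates hold, where $\|f'\|_\infty:=\sup_{\mathbb{R}}|f'|$: $$\|u^\epsilon(t)\|_{L^2(\mathbb{R})}\le \|u_0^\epsilon\|_{L^2(\mathbb{R})}\quad\text{for all } t\ge 0,$$ $$\sqrt{2\epsilon}\,\|u^\epsilon_x\|_{L^2(\mathbb{R}^+,L^2(\mathbb{R}))}\le \|u_0^\epsilon\|_{L^2(\mathbb{R})},$$ $$\sqrt{\delta}\,\|u^\epsilon_x(t)\|_{L^2(\mathbb{R})}\le \sqrt{2\|f'\|_\infty}\,\|u_0^\epsilon\|_{L^2(\mathbb{R})}+\sqrt{\delta}\,\|u^\epsilon_{0x}\|_{L^2(\mathbb{R})}\quad\text{for all } t\ge 0,$$ $$\sqrt{\epsilon\,\delta}\,\|u^\epsilon_{xx}\|_{L^2(\mathbb{R}^+,L^2(\mathbb{R}))}\le \sqrt{2\|f'\|_\infty}\,\|u_0^\epsilon\|_{L^2(\mathbb{R})}+\sqrt{\delta}\,\|u^\epsilon_{0x}\|_{L^2(\mathbb{R})}.$$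
   Context: Standing assumptions: the initial data $u_0^\epsilon:\mathbb{R}\to\mathbb{R}$ are such that the solution $u^\epsilon=u^\epsilon(x,t)$ is smooth on $\mathbb{R}\times[0,\infty)$ and $u^\epsilon$ together with its derivatives decays rapidly as $|x|\to\infty$ (locally uniformly in $t\ge0$), so that integrations by parts in $x$ produce no boundary terms. It is also assumed that $u_0^\epsilon\rightharpoonup u_0$ weakly in $L^2(\mathbb{R})$ as $\epsilon\to0+$, with $\delta(\epsilon)\to0$. Here $u^\epsilon_{0x}$ denotes the derivative of $u_0^\epsilon$, and $\|v\|_{L^2(\mathbb{R}^+,L^2(\mathbb{R}))}^2=\int_0^\infty\int_{\mathbb{R}}|v(x,t)|^2\,dx\,dt$. *)

theory Defs
  imports "HOL-Analysis.Analysis"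
begin

definition ennreal_sqrt :: "ennreal \<Rightarrow> ennreal" where
  "ennreal_sqrt a = (if a = \<infinity> then \<infinity> else ennreal (sqrt (enn2real a)))"

(* Norms take values in [0,\<infinity>], so an upper bound on a norm with positive coefficient
   includes the claim that the norm is finite; in ennreal, 0 * \<infinity> = 0. *)

definition L2_norm :: "(real \<Rightarrow> real) \<Rightarrow> ennreal" where
  "L2_norm v = ennreal_sqrt (\<integral>\<^sup>+x. ennreal (\<bar>v x\<bar>\<^sup>2) \<partial>lborel)"

definition L2_time_norm :: "(real \<Rightarrow> real \<Rightarrow> real) \<Rightarrow> ennreal" where
  "L2_time_norm v =
     ennreal_sqrt (\<integral>\<^sup>+t\<in>{0..}. (\<integral>\<^sup>+x. ennreal (\<bar>v x t\<bar>\<^sup>2) \<partial>lborel) \<partial>lborel)"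

(* Borel representatives of the classes in L2 of the real line. *)
definition L2_space :: "(real \<Rightarrow> real) set" where
  "L2_space = {v \<in> borel_measurable lborel. L2_norm v < \<infinity>}"

definition weakly_tendsto_L2 ::
  "('i \<Rightarrow> real \<Rightarrow> real) \<Rightarrow> (real \<Rightarrow> real) \<Rightarrow> 'i filter \<Rightarrow> bool" where
  "weakly_tendsto_L2 g g0 F \<longleftrightarrow>
     (\<forall>\<^sub>F i in F. g i \<in> L2_space) \<and> g0 \<in> L2_space \<and>
     (\<forall>\<phi>\<in>L2_space. ((\<lambda>i. LINT x|lborel. g i x * \<phi> x) \<longlongrightarrow> (LINT x|lborel. g0 x * \<phi> x)) F)"

definition smooth_real :: "(real \<Rightarrow> real) \<Rightarrow> bool" where
  "smooth_real f \<longleftrightarrow> (\<forall>k x. ((deriv ^^ k) f) differentiable (at x))"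

(* Functions on the closed half-plane t \<ge> 0 are total functions of x and t whose values at t < 0
   are irrelevant; the time derivative is one-sided at t = 0. *)

definition partial_x :: "(real \<Rightarrow> real \<Rightarrow> real) \<Rightarrow> real \<Rightarrow> real \<Rightarrow> real" where
  "partial_x v = (\<lambda>x t. deriv (\<lambda>y. v y t) x)"

definition partial_t :: "(real \<Rightarrow> real \<Rightarrow> real) \<Rightarrow> real \<Rightarrow> real \<Rightarrow> real" where
  "partial_t v = (\<lambda>x t. vector_derivative (\<lambda>s. v x s) (at t within {0..}))"

(* All mixed partial derivatives of u, of every order including 0. *)
inductive_set partials :: "(real \<Rightarrow> real \<Rightarrow> real) \<Rightarrow> (real \<Rightarrow> real \<Rightarrow> real) set"
  for u :: "real \<Rightarrow> real \<Rightarrow> real" where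
  base: "u \<in> partials u"
| space: "v \<in> partials u \<Longrightarrow> partial_x v \<in> partials u"
| time: "v \<in> partials u \<Longrightarrow> partial_t v \<in> partials u"

definition smooth_halfplane :: "(real \<Rightarrow> real \<Rightarrow> real) \<Rightarrow> bool" where
  "smooth_halfplane u \<longleftrightarrow> (\<forall>v\<in>partials u.
     continuous_on (UNIV \<times> {0..}) (\<lambda>(x, t). v x t) \<and>
     (\<forall>x. \<forall>t\<ge>0. (\<lambda>y. v y t) differentiable (at x) \<and>
                (\<lambda>s. v x s) differentiable (at t within {0..})))"

definition rapidly_decaying :: "(real \<Rightarrow> real \<Rightarrow> real) \<Rightarrow> bool" where
  "rapidly_decaying u \<longleftrightarrow> (\<forall>v\<in>partials u. \<forall>(T::real) (k::nat).
     \<exists>C. \<forall>x. \<forall>t\<in>{0..T}. \<bar>x\<bar> ^ k * \<bar>v x t\<bar> \<le> C)"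

definition solves_cauchy_problem ::
  "(real \<Rightarrow> real) \<Rightarrow> real \<Rightarrow> real \<Rightarrow> (real \<Rightarrow> real) \<Rightarrow> (real \<Rightarrow> real \<Rightarrow> real) \<Rightarrow> bool" where
  "solves_cauchy_problem f \<epsilon> \<delta> g u \<longleftrightarrow>
     (\<forall>x. \<forall>t\<ge>0. partial_t u x t + partial_x (\<lambda>y s. f (u y s)) x t =
        \<epsilon> * partial_x (partial_x u) x t + \<delta> * partial_x (partial_x (partial_x u)) x t) \<and>
     (\<forall>x. u x 0 = g x)"

definition sup_norm :: "(real \<Rightarrow> real) \<Rightarrow> real" where
  "sup_norm g = (SUP x. \<bar>g x\<bar>)"

end

theory Submission
  imports Defs "HOL-Probability.Sinc_Integral" "HOL-Real_Asymp.Real_Asymp"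
begin

text \<open>
  Two balance laws carry the proof. Write \<open>F\<close> for the primitive of \<open>f - f 0\<close> that vanishes
  at \<open>0\<close> and \<open>M\<close> for the supremum of \<open>\<bar>f'\<bar>\<close>, so that \<open>\<bar>F s\<bar> \<le> M / 2 * s\<^sup>2\<close>.

  Multiplying the equation by \<open>2 * u\<close> makes the flux and the dispersion terms exact \<open>x\<close>-derivatives,
  and the diffusion term is \<open>- 2 * \<epsilon> * u\<^sub>x\<^sup>2\<close> plus such a derivative. Integration gives
  \<open>\<integral>u\<^sup>2(T) + 2 * \<epsilon> * \<integral>\<integral>u\<^sub>x\<^sup>2 = \<integral>u\<^sup>2(0)\<close> (\<open>energy_balance\<close>), which contains the
  first two estimates.

  For \<open>\<epsilon> = 0\<close> the equation is Hamiltonian, with conserved quantity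
  \<open>H = \<integral>\<delta> / 2 * u\<^sub>x\<^sup>2 + F(u)\<close>: it reads \<open>u\<^sub>t = w\<^sub>x\<close> where \<open>w = \<delta> * u\<^sub>x\<^sub>x - (f(u) - f 0)\<close>
  is minus the variational derivative of \<open>H\<close>. With diffusion, \<open>H\<close> changes at the rate
  \<open>- \<epsilon> * \<integral>w * u\<^sub>x\<^sub>x = - \<epsilon> * \<delta> * \<integral>u\<^sub>x\<^sub>x\<^sup>2 - \<epsilon> * \<integral>f'(u) * u\<^sub>x\<^sup>2\<close>
  (\<open>dispersive_energy_balance\<close>). The terms without a sign are at most
  \<open>M / 2 * \<integral>u\<^sup>2(T)\<close>, \<open>M / 2 * \<integral>u\<^sup>2(0)\<close> and \<open>\<epsilon> * M * \<integral>\<integral>u\<^sub>x\<^sup>2\<close>. By the first balance law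
  the first and the third of these add up to exactly \<open>M / 2 * \<integral>u\<^sup>2(0)\<close>, so that
  \<open>\<delta> * \<integral>u\<^sub>x\<^sup>2(T) + 2 * \<epsilon> * \<delta> * \<integral>\<integral>u\<^sub>x\<^sub>x\<^sup>2 \<le> 2 * M * \<integral>u\<^sup>2(0) + \<delta> * \<integral>u\<^sub>x\<^sup>2(0)\<close>
  (\<open>gradient_estimate\<close>). Subadditivity of the square root turns this into the last two estimates.

  Analytically, both laws are instances of \<open>balance_law_integral\<close>: a local law
  \<open>h\<^sub>t + d = P\<^sub>x\<close> is integrated over a slab \<open>\<real> \<times> {0..T}\<close>, where Fubini's theorem
  takes the place of differentiation under the integral sign. The integral over the whole half-line of
  times is the supremum of the slab integrals.
\<close>

section \<open>Decaying functions on the half-plane\<close>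

text \<open>The majorant \<open>inverse (1 + x\<^sup>2)\<close> is integrable and tends to \<open>0\<close>. Asking for this much decay only,
  rather than decay faster than every power, gives a class that contains the partial derivatives of the
  solution and is closed under sums, products and domination.\<close>

definition slab_decaying :: "(real \<Rightarrow> real \<Rightarrow> real) \<Rightarrow> bool" where
  "slab_decaying v \<longleftrightarrow> continuous_on (UNIV \<times> {0..}) (\<lambda>(x, t). v x t) \<and>
     (\<forall>T. \<exists>C. \<forall>x. \<forall>t\<in>{0..T}. \<bar>v x t\<bar> \<le> C * inverse (1 + x\<^sup>2))"

lemma slab_decaying_continuous:
  "slab_decaying v \<Longrightarrow> continuous_on (UNIV \<times> {0..}) (\<lambda>(x, t). v x t)"
  by (simp add: slab_decaying_def)

lemma slab_decaying_bound:
  assumes "slab_decaying v"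
  obtains C where "C \<ge> 0" "\<And>x t. t \<in> {0..T} \<Longrightarrow> \<bar>v x t\<bar> \<le> C * inverse (1 + x\<^sup>2)"
proof -
  obtain C where C: "\<And>x t. t \<in> {0..T} \<Longrightarrow> \<bar>v x t\<bar> \<le> C * inverse (1 + x\<^sup>2)"
    using assms unfolding slab_decaying_def by blast
  show thesis
  proof (rule that[of "\<bar>C\<bar>"])
    fix x t assume "t \<in> {0..T}"
    then have "\<bar>v x t\<bar> \<le> C * inverse (1 + x\<^sup>2)" by (rule C)
    also have "\<dots> \<le> \<bar>C\<bar> * inverse (1 + x\<^sup>2)"
      by (intro mult_right_mono) auto
    finally show "\<bar>v x t\<bar> \<le> \<bar>C\<bar> * inverse (1 + x\<^sup>2)" .
  qed simp
qed

lemma slab_decaying_dominated: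
  assumes v: "slab_decaying v"
    and w: "continuous_on (UNIV \<times> {0..}) (\<lambda>(x, t). w x t)"
    and le: "\<And>x t. t \<ge> 0 \<Longrightarrow> \<bar>w x t\<bar> \<le> B * \<bar>v x t\<bar>"
  shows "slab_decaying w"
  unfolding slab_decaying_def
proof (intro conjI allI)
  fix T
  obtain C where C: "C \<ge> 0" "\<And>x t. t \<in> {0..T} \<Longrightarrow> \<bar>v x t\<bar> \<le> C * inverse (1 + x\<^sup>2)"
    using slab_decaying_bound[OF v] by blast
  show "\<exists>C. \<forall>x. \<forall>t\<in>{0..T}. \<bar>w x t\<bar> \<le> C * inverse (1 + x\<^sup>2)"
  proof (intro exI allI ballI)
    fix x t :: real assume t: "t \<in> {0..T}"
    have "\<bar>w x t\<bar> \<le> B * \<bar>v x t\<bar>" using le t by auto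
    also have "\<dots> \<le> \<bar>B\<bar> * \<bar>v x t\<bar>" by (intro mult_right_mono) auto
    also have "\<dots> \<le> \<bar>B\<bar> * (C * inverse (1 + x\<^sup>2))" using C(2)[OF t] by (intro mult_left_mono) auto
    finally show "\<bar>w x t\<bar> \<le> (\<bar>B\<bar> * C) * inverse (1 + x\<^sup>2)" by (simp add: mult.assoc)
  qed
qed (use w in auto)

lemma slab_decaying_cmult:
  assumes "slab_decaying v" shows "slab_decaying (\<lambda>x t. c * v x t)"
  by (rule slab_decaying_dominated[OF assms, where B = "\<bar>c\<bar>"])
     (use slab_decaying_continuous[OF assms] in
      \<open>auto simp: split_beta abs_mult intro!: continuous_intros\<close>)

lemma slab_decaying_add:
  assumes v: "slab_decaying v" and w: "slab_decaying w"
  shows "slab_decaying (\<lambda>x t. v x t + w x t)"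
  unfolding slab_decaying_def
proof (intro conjI allI)
  show "continuous_on (UNIV \<times> {0..}) (\<lambda>(x, t). v x t + w x t)"
    using slab_decaying_continuous[OF v] slab_decaying_continuous[OF w]
    by (auto simp: split_beta intro!: continuous_intros)
  fix T
  obtain C where C: "C \<ge> 0" "\<And>x t. t \<in> {0..T} \<Longrightarrow> \<bar>v x t\<bar> \<le> C * inverse (1 + x\<^sup>2)"
    using slab_decaying_bound[OF v] by blast
  obtain D where D: "D \<ge> 0" "\<And>x t. t \<in> {0..T} \<Longrightarrow> \<bar>w x t\<bar> \<le> D * inverse (1 + x\<^sup>2)"
    using slab_decaying_bound[OF w] by blast
  show "\<exists>C. \<forall>x. \<forall>t\<in>{0..T}. \<bar>v x t + w x t\<bar> \<le> C * inverse (1 + x\<^sup>2)"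
  proof (intro exI allI ballI)
    fix x t :: real assume t: "t \<in> {0..T}"
    show "\<bar>v x t + w x t\<bar> \<le> (C + D) * inverse (1 + x\<^sup>2)"
      using C(2)[OF t, of x] D(2)[OF t, of x] abs_triangle_ineq[of "v x t" "w x t"]
      unfolding distrib_right by linarith
  qed
qed

lemma slab_decaying_diff:
  assumes "slab_decaying v" and "slab_decaying w"
  shows "slab_decaying (\<lambda>x t. v x t - w x t)"
  using slab_decaying_add[OF assms(1) slab_decaying_cmult[OF assms(2), of "-1"]] by simp

lemma slab_decaying_mult:
  assumes v: "slab_decaying v" and w: "slab_decaying w"
  shows "slab_decaying (\<lambda>x t. v x t * w x t)"
  unfolding slab_decaying_def
proof (intro conjI allI)
  show "continuous_on (UNIV \<times> {0..}) (\<lambda>(x, t). v x t * w x t)"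
    using slab_decaying_continuous[OF v] slab_decaying_continuous[OF w]
    by (auto simp: split_beta intro!: continuous_intros)
  fix T
  obtain C where C: "C \<ge> 0" "\<And>x t. t \<in> {0..T} \<Longrightarrow> \<bar>v x t\<bar> \<le> C * inverse (1 + x\<^sup>2)"
    using slab_decaying_bound[OF v] by blast
  obtain D where D: "D \<ge> 0" "\<And>x t. t \<in> {0..T} \<Longrightarrow> \<bar>w x t\<bar> \<le> D * inverse (1 + x\<^sup>2)"
    using slab_decaying_bound[OF w] by blast
  show "\<exists>C. \<forall>x. \<forall>t\<in>{0..T}. \<bar>v x t * w x t\<bar> \<le> C * inverse (1 + x\<^sup>2)"
  proof (intro exI allI ballI)
    fix x t :: real assume t: "t \<in> {0..T}"
    have "inverse (1 + x\<^sup>2) \<le> 1"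
      by (simp add: inverse_le_1_iff)
    then have "D * inverse (1 + x\<^sup>2) \<le> D * 1" using D(1) by (intro mult_left_mono)
    then have "\<bar>w x t\<bar> \<le> D" using D(2)[OF t, of x] by linarith
    then have "\<bar>v x t\<bar> * \<bar>w x t\<bar> \<le> (C * inverse (1 + x\<^sup>2)) * D"
      using C(2)[OF t, of x] by (intro mult_mono) auto
    then show "\<bar>v x t * w x t\<bar> \<le> (C * D) * inverse (1 + x\<^sup>2)"
      by (simp add: abs_mult mult_ac)
  qed
qed

lemma slab_decaying_square: "slab_decaying v \<Longrightarrow> slab_decaying (\<lambda>x t. (v x t)\<^sup>2)"
  using slab_decaying_mult[of v v] by (simp add: power2_eq_square)

lemma integrable_inverse_square: "integrable lborel (\<lambda>x::real. inverse (1 + x\<^sup>2))"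
  using integrable_inverse_1_plus_square by (simp add: set_integrable_def einterval_def)

lemma continuous_on_space_slice:
  assumes "continuous_on (UNIV \<times> {0..}) (\<lambda>(x, t). v x t)" and "t \<ge> (0::real)"
  shows "continuous_on UNIV (\<lambda>x::real. v x t :: real)"
  using assms(2)
  by (intro continuous_on_compose2[OF assms(1), where f = "\<lambda>x. (x, t)", simplified])
     (auto intro!: continuous_intros)

lemma continuous_on_time_slice:
  assumes "continuous_on (UNIV \<times> {0..}) (\<lambda>(x, t). v x t)"
  shows "continuous_on {0..T} (\<lambda>t::real. v (x::real) t :: real)"
  by (intro continuous_on_compose2[OF assms(1), where f = "\<lambda>t. (x, t)", simplified])
     (auto intro!: continuous_intros)

lemma slab_decaying_integrable:
  assumes v: "slab_decaying v" and t: "t \<ge> 0"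
  shows "integrable lborel (\<lambda>x. v x t)"
proof -
  obtain C where C: "C \<ge> 0" "\<And>x s. s \<in> {0..t} \<Longrightarrow> \<bar>v x s\<bar> \<le> C * inverse (1 + x\<^sup>2)"
    using slab_decaying_bound[OF v] by blast
  have [measurable]: "(\<lambda>x. v x t) \<in> borel_measurable borel"
    using continuous_on_space_slice[OF slab_decaying_continuous[OF v] t]
    by (rule borel_measurable_continuous_onI)
  show ?thesis
  proof (rule Bochner_Integration.integrable_bound)
    show "integrable lborel (\<lambda>x. C * inverse (1 + x\<^sup>2))"
      using integrable_inverse_square by (rule integrable_mult_right)
    show "AE x in lborel. norm (v x t) \<le> norm (C * inverse (1 + x\<^sup>2))"
    proof (rule AE_I2)
      fix x
      show "norm (v x t) \<le> norm (C * inverse (1 + x\<^sup>2))"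
        using C(2)[of t x] t by simp
    qed
  qed simp
qed

lemma slab_decaying_tendsto_0:
  assumes v: "slab_decaying v" and t: "t \<ge> 0"
  shows "((\<lambda>x. v x t) \<longlongrightarrow> 0) at_top" and "((\<lambda>x. v x t) \<longlongrightarrow> 0) at_bot"
proof -
  obtain C where C: "C \<ge> 0" "\<And>x s. s \<in> {0..t} \<Longrightarrow> \<bar>v x s\<bar> \<le> C * inverse (1 + x\<^sup>2)"
    using slab_decaying_bound[OF v] by blast
  have le: "\<bar>v x t\<bar> \<le> C * inverse (1 + x\<^sup>2)" for x using C(2)[of t x] t by simp
  have "((\<lambda>x. C * inverse (1 + x\<^sup>2)) \<longlongrightarrow> 0) at_top" by real_asymp
  then show "((\<lambda>x. v x t) \<longlongrightarrow> 0) at_top"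
    by (rule Lim_null_comparison[rotated]) (simp add: le)
  have "((\<lambda>x. C * inverse (1 + x\<^sup>2)) \<longlongrightarrow> 0) at_bot" by real_asymp
  then show "((\<lambda>x. v x t) \<longlongrightarrow> 0) at_bot"
    by (rule Lim_null_comparison[rotated]) (simp add: le)
qed

text \<open>This is the absence of boundary terms when integrating by parts in \<open>x\<close>.\<close>

lemma integral_flux_derivative_eq_0:
  assumes P: "slab_decaying P" and p: "slab_decaying p" and t: "t \<ge> 0"
    and deriv: "\<And>x. ((\<lambda>y. P y t) has_real_derivative p x t) (at x)"
  shows "(\<integral>x. p x t \<partial>lborel) = 0"
proof -
  have "(LBINT x=-\<infinity>..\<infinity>. p x t) = 0 - 0"
  proof (rule interval_integral_FTC_integrable)
    show "((\<lambda>y. P y t) has_vector_derivative p x t) (at x)" for x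
      using deriv by (simp add: has_real_derivative_iff_has_vector_derivative)
    show "isCont (\<lambda>x. p x t) x" for x
      using continuous_on_space_slice[OF slab_decaying_continuous[OF p] t]
      by (simp add: continuous_on_eq_continuous_at)
    show "set_integrable lborel (einterval (- \<infinity>) \<infinity>) (\<lambda>x. p x t)"
      using slab_decaying_integrable[OF p t] by (simp add: set_integrable_def einterval_def)
    show "(((\<lambda>y. P y t) \<circ> real_of_ereal) \<longlongrightarrow> 0) (at_right (- \<infinity>))"
      using slab_decaying_tendsto_0(2)[OF P t] by (simp add: ereal_tendsto_simps)
    show "(((\<lambda>y. P y t) \<circ> real_of_ereal) \<longlongrightarrow> 0) (at_left \<infinity>)"
      using slab_decaying_tendsto_0(1)[OF P t] by (simp add: ereal_tendsto_simps)
  qed simp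
  then show ?thesis
    by (simp add: interval_lebesgue_integral_def set_lebesgue_integral_def einterval_def)
qed

section \<open>Integrals over space-time slabs\<close>

definition slab_integral :: "real \<Rightarrow> (real \<Rightarrow> real \<Rightarrow> real) \<Rightarrow> real" where
  "slab_integral T v =
     (\<integral>(x, t). indicator {0..T} t * v x t \<partial>(lborel \<Otimes>\<^sub>M lborel))"

lemma slab_integrable:
  assumes v: "slab_decaying v"
  shows "integrable (lborel \<Otimes>\<^sub>M lborel) (\<lambda>(x, t). indicator {0..T} t * v x t)"
proof -
  obtain C where C: "C \<ge> 0" "\<And>x t. t \<in> {0..T} \<Longrightarrow> \<bar>v x t\<bar> \<le> C * inverse (1 + x\<^sup>2)"
    using slab_decaying_bound[OF v] by blast
  have "(\<lambda>z. indicator (UNIV \<times> {0..T}) z *\<^sub>R (case z of (x, t) \<Rightarrow> v x t)) \<in> borel_measurable borel"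
    by (rule borel_measurable_continuous_on_indicator)
       (auto intro!: borel_closed closed_Times
          continuous_on_subset[OF slab_decaying_continuous[OF v]])
  also have "(\<lambda>z. indicator (UNIV \<times> {0..T}) z *\<^sub>R (case z of (x, t) \<Rightarrow> v x t))
      = (\<lambda>(x, t). indicator {0..T} t * v x t)"
    by (auto simp: indicator_def)
  finally have meas: "(\<lambda>(x, t). indicator {0..T} t * v x t)
      \<in> borel_measurable (lborel \<Otimes>\<^sub>M lborel)"
    by (simp add: lborel_prod)
  have dom: "integrable (lborel \<Otimes>\<^sub>M lborel)
      (\<lambda>(x, t). (C * inverse (1 + x\<^sup>2)) * indicator {0..T} t :: real)"
  proof (rule lborel_pair.Fubini_integrable)
    have "integrable lborel (\<lambda>x. C * inverse (1 + x\<^sup>2) * measure lborel {0..T})"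
      using integrable_inverse_square
      by (intro integrable_mult_left integrable_mult_right)
    moreover have "(\<integral>t. norm ((C * inverse (1 + x\<^sup>2)) * indicator {0..T} t) \<partial>lborel)
        = C * inverse (1 + x\<^sup>2) * measure lborel {0..T}" for x
    proof -
      have "(\<lambda>t. norm ((C * inverse (1 + x\<^sup>2)) * indicator {0..T} t))
          = (\<lambda>t. C * inverse (1 + x\<^sup>2) * indicator {0..T} t)"
        using C(1) by (auto simp: indicator_def fun_eq_iff)
      then show ?thesis by simp
    qed
    ultimately show "integrable lborel (\<lambda>x. \<integral>t. norm (case (x, t) of (x, t) \<Rightarrow>
        (C * inverse (1 + x\<^sup>2)) * indicator {0..T} t) \<partial>lborel)"
      by simp
    have "integrable lborel (indicator {0..T} :: real \<Rightarrow> real)"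
      by (rule integrable_real_indicator) (auto simp: emeasure_lborel_Icc_eq)
    then show "AE x in lborel. integrable lborel (\<lambda>t. case (x, t) of (x, t) \<Rightarrow>
        (C * inverse (1 + x\<^sup>2)) * indicator {0..T} t)"
      by simp
  qed (simp add: split_beta)
  show ?thesis
  proof (rule Bochner_Integration.integrable_bound[OF dom meas AE_I2])
    fix z :: "real \<times> real"
    show "norm (case z of (x, t) \<Rightarrow> indicator {0..T} t * v x t)
        \<le> norm (case z of (x, t) \<Rightarrow> C * inverse (1 + x\<^sup>2) * indicator {0..T} t)"
    proof (cases z)
      case (Pair x t)
      have "norm (C * inverse (1 + x\<^sup>2)) = C * inverse (1 + x\<^sup>2)"
        using C(1) by simp
      then show ?thesis
        unfolding Pair using C(2)[of t x]
        by (cases "t \<in> {0..T}") auto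
    qed
  qed
qed

lemma slab_integral_space_time:
  assumes "slab_decaying v"
  shows "slab_integral T v = (\<integral>x. (\<integral>t. indicator {0..T} t * v x t \<partial>lborel) \<partial>lborel)"
  unfolding slab_integral_def using lborel_pair.integral_fst[OF slab_integrable[OF assms]] by simp

lemma slab_integral_time_space:
  assumes "slab_decaying v"
  shows "slab_integral T v = (\<integral>t. indicator {0..T} t * (\<integral>x. v x t \<partial>lborel) \<partial>lborel)"
  unfolding slab_integral_def using lborel_pair.integral_snd[OF slab_integrable[OF assms]] by simp

lemma slab_integral_add:
  assumes "slab_decaying v" and "slab_decaying w"
  shows "slab_integral T (\<lambda>x t. v x t + w x t) = slab_integral T v + slab_integral T w"
  unfolding slab_integral_def
  using Bochner_Integration.integral_add[OF 
      slab_integrable[OF assms(1), of T] slab_integrable[OF assms(2), of T]]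
  by (simp add: case_prod_unfold distrib_left)

lemma slab_integral_cmult: "slab_integral T (\<lambda>x t. c * v x t) = c * slab_integral T v"
  unfolding slab_integral_def
  by (subst integral_mult_right_zero[symmetric]) (simp add: case_prod_unfold mult_ac)

lemma slab_integral_mono:
  assumes "slab_decaying v" and "slab_decaying w"
    and "\<And>x t. t \<ge> 0 \<Longrightarrow> v x t \<le> w x t"
  shows "slab_integral T v \<le> slab_integral T w"
  unfolding slab_integral_def
  by (intro integral_mono slab_integrable assms)
     (use assms(3) in \<open>auto simp: indicator_def\<close>)

lemma slab_integral_nonneg:
  assumes "\<And>x t. v x t \<ge> 0"
  shows "slab_integral T v \<ge> 0"
  unfolding slab_integral_def by (rule Bochner_Integration.integral_nonneg) (auto simp: assms)

text \<open>The slab integral of \<open>h\<^sub>t\<close> is evaluated in both orders. Integrating first in time gives the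
  difference of the total densities at \<open>T\<close> and \<open>0\<close>; integrating first in space, the flux \<open>P\<^sub>x\<close>
  contributes nothing and only the dissipation \<open>d\<close> is left.\<close>

lemma balance_law_integral:
  assumes h: "slab_decaying h" and a: "slab_decaying a"
    and P: "slab_decaying P" and d: "slab_decaying d"
    and time: "\<And>x t. t \<ge> 0 \<Longrightarrow> ((\<lambda>s. h x s) has_real_derivative a x t) (at t within {0..})"
    and space: "\<And>x t. t \<ge> 0 \<Longrightarrow> ((\<lambda>y. P y t) has_real_derivative a x t + d x t) (at x)"
    and T: "T \<ge> 0"
  shows "(\<integral>x. h x T \<partial>lborel) + slab_integral T d = (\<integral>x. h x 0 \<partial>lborel)"
proof -
  have p: "slab_decaying (\<lambda>x t. a x t + d x t)"
    by (rule slab_decaying_add[OF a d])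
  have "slab_integral T a = (\<integral>x. h x T - h x 0 \<partial>lborel)"
  proof -
    have "(\<integral>t. indicator {0..T} t *\<^sub>R a x t \<partial>lborel) = h x T - h x 0" for x
    proof (rule integral_FTC_atLeastAtMost[OF T])
      fix t assume "0 \<le> t" "t \<le> T"
      then have "((\<lambda>s. h x s) has_vector_derivative a x t) (at t within {0..})"
        using time by (simp add: has_real_derivative_iff_has_vector_derivative)
      then show "((\<lambda>s. h x s) has_vector_derivative a x t) (at t within {0..T})"
        by (rule has_vector_derivative_within_subset) auto
    qed (rule continuous_on_time_slice[OF slab_decaying_continuous[OF a]])
    then show ?thesis by (simp add: slab_integral_space_time[OF a])
  qed
  also have "\<dots> = (\<integral>x. h x T \<partial>lborel) - (\<integral>x. h x 0 \<partial>lborel)"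
    using T by (intro Bochner_Integration.integral_diff slab_decaying_integrable[OF h]) auto
  finally have *: "slab_integral T a = (\<integral>x. h x T \<partial>lborel) - (\<integral>x. h x 0 \<partial>lborel)" .
  have "slab_integral T a + slab_integral T d = slab_integral T (\<lambda>x t. a x t + d x t)"
    by (rule slab_integral_add[OF a d, symmetric])
  also have "\<dots> = (\<integral>t. indicator {0..T} t * (\<integral>x. a x t + d x t \<partial>lborel) \<partial>lborel)"
    by (rule slab_integral_time_space[OF p])
  also have "\<dots> = (\<integral>t. 0 \<partial>(lborel :: real measure))"
  proof (intro Bochner_Integration.integral_cong refl)
    fix t :: real
    show "indicator {0..T} t * (\<integral>x. a x t + d x t \<partial>lborel) = 0"
      using integral_flux_derivative_eq_0[OF P p, of t] space by (cases "t \<ge> 0") auto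
  qed
  finally show ?thesis using * by simp
qed

section \<open>Passing to norms in the extended half-line\<close>

lemma ennreal_sqrt_ennreal: "a \<ge> 0 \<Longrightarrow> ennreal_sqrt (ennreal a) = ennreal (sqrt a)"
  by (simp add: ennreal_sqrt_def)

lemma ennreal_sqrt_le:
  assumes "a \<le> ennreal K" shows "ennreal_sqrt a \<le> ennreal (sqrt K)"
proof (cases "K \<ge> 0")
  case True
  with assms obtain b where b: "a = ennreal b" "b \<ge> 0" 
    by (cases a) (auto simp: top_unique)
  then show ?thesis using assms True by (simp add: ennreal_sqrt_ennreal ennreal_leI)
next
  case False
  then have "a = 0" using assms by (simp add: ennreal_neg)
  then show ?thesis by (simp add: ennreal_sqrt_def)
qed

lemma L2_norm_slice:
  assumes "slab_decaying v" and "t \<ge> 0"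
  shows "L2_norm (\<lambda>x. v x t) = ennreal (sqrt (\<integral>x. (v x t)\<^sup>2 \<partial>lborel))"
  unfolding L2_norm_def
  using nn_integral_eq_integral[OF slab_decaying_integrable[OF slab_decaying_square[OF assms(1)] assms(2)]]
  by (simp add: ennreal_sqrt_ennreal)

text \<open>Monotone convergence along the slabs \<open>\<real> \<times> {0..n}\<close>: a bound uniform in the length of the
  slab bounds the integral over all times.\<close>

lemma L2_time_norm_le:
  assumes v: "slab_decaying v"
    and le: "\<And>T. T \<ge> 0 \<Longrightarrow> slab_integral T (\<lambda>x t. (v x t)\<^sup>2) \<le> K"
  shows "L2_time_norm v \<le> ennreal (sqrt K)"
proof -
  define g where "g = (\<lambda>t. \<integral>x. (v x t)\<^sup>2 \<partial>lborel)"
  note sq = slab_decaying_square[OF v]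
  have g_nonneg: "g t \<ge> 0" for t by (simp add: g_def)
  have inner: "(\<integral>\<^sup>+x. ennreal (\<bar>v x t\<bar>\<^sup>2) \<partial>lborel) = ennreal (g t)" if "t \<ge> 0" for t
    using nn_integral_eq_integral[OF slab_decaying_integrable[OF sq that]] by (simp add: g_def)
  have int: "integrable lborel (\<lambda>t. indicator {0..T} t * g t)" for T
    using lborel_pair.integrable_snd[OF slab_integrable[OF sq, of T]] by (simp add: g_def)
  have slab: "(\<integral>\<^sup>+t. ennreal (indicator {0..T} t * g t) \<partial>lborel)
      = ennreal (slab_integral T (\<lambda>x t. (v x t)\<^sup>2))" for T
    unfolding slab_integral_time_space[OF sq]
    using nn_integral_eq_integral[OF int] by (simp add: g_def g_nonneg)
  have "(\<integral>\<^sup>+t\<in>{0..}. (\<integral>\<^sup>+x. ennreal (\<bar>v x t\<bar>\<^sup>2) \<partial>lborel) \<partial>lborel)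
      = (\<integral>\<^sup>+t. (SUP n::nat. ennreal (indicator {0..real n} t * g t)) \<partial>lborel)"
  proof (rule nn_integral_cong)
    fix t :: real
    show "(\<integral>\<^sup>+x. ennreal (\<bar>v x t\<bar>\<^sup>2) \<partial>lborel) * indicator {0..} t
        = (SUP n::nat. ennreal (indicator {0..real n} t * g t))"
    proof (cases "t \<ge> 0")
      case True
      obtain n :: nat where "t \<le> real n" using real_arch_simple by blast
      then have "ennreal (indicator {0..real n} t * g t) = ennreal (g t)" using True by simp
      moreover have "ennreal (indicator {0..real m} t * g t) \<le> ennreal (g t)" for m
        by (intro ennreal_leI) (simp add: indicator_def g_nonneg)
      ultimately have "(SUP n::nat. ennreal (indicator {0..real n} t * g t)) = ennreal (g t)"
        by (intro antisym SUP_least) (auto intro: SUP_upper2[of n])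
      then show ?thesis using inner[OF True] True by simp
    qed simp
  qed
  also have "\<dots> = (SUP n::nat. \<integral>\<^sup>+t. ennreal (indicator {0..real n} t * g t) \<partial>lborel)"
  proof (rule nn_integral_monotone_convergence_SUP)
    show "incseq (\<lambda>(n::nat) t. ennreal (indicator {0..real n} t * g t))"
      by (auto simp: incseq_def le_fun_def indicator_def g_nonneg intro!: ennreal_leI)
    show "(\<lambda>t. ennreal (indicator {0..real n} t * g t)) \<in> borel_measurable lborel" for n
      using borel_measurable_integrable[OF int] by simp
  qed
  also have "\<dots> \<le> ennreal K"
    unfolding slab by (intro SUP_least ennreal_leI le) simp
  finally show ?thesis
    unfolding L2_time_norm_def by (rule ennreal_sqrt_le)
qed

section \<open>Partial derivatives of a smooth, rapidly decaying function\<close>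

text \<open>The decay rates \<open>k = 0\<close> and \<open>k = 2\<close> together bound \<open>(1 + x\<^sup>2) * \<bar>v x t\<bar>\<close>.\<close>

lemma slab_decaying_partials:
  assumes smooth: "smooth_halfplane u" and decay: "rapidly_decaying u" and v: "v \<in> partials u"
  shows "slab_decaying v"
  unfolding slab_decaying_def
proof (intro conjI allI)
  show "continuous_on (UNIV \<times> {0..}) (\<lambda>(x, t). v x t)"
    using smooth v by (simp add: smooth_halfplane_def)
  fix T
  obtain C0 where C0: "\<And>x t. t \<in> {0..T} \<Longrightarrow> \<bar>x\<bar> ^ 0 * \<bar>v x t\<bar> \<le> C0"
    using decay v unfolding rapidly_decaying_def by meson
  obtain C2 where C2: "\<And>x t. t \<in> {0..T} \<Longrightarrow> \<bar>x\<bar> ^ 2 * \<bar>v x t\<bar> \<le> C2"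
    using decay v unfolding rapidly_decaying_def by meson
  show "\<exists>C. \<forall>x. \<forall>t\<in>{0..T}. \<bar>v x t\<bar> \<le> C * inverse (1 + x\<^sup>2)"
  proof (intro exI allI ballI)
    fix x t :: real assume t: "t \<in> {0..T}"
    have pos: "1 + x\<^sup>2 > 0" by (simp add: add_pos_nonneg)
    have "(1 + x\<^sup>2) * \<bar>v x t\<bar> \<le> C0 + C2"
      using C0[OF t, of x] C2[OF t, of x] by (simp add: distrib_right)
    then show "\<bar>v x t\<bar> \<le> (C0 + C2) * inverse (1 + x\<^sup>2)"
      using pos by (simp add: field_simps)
  qed
qed

lemma partials_has_space_derivative:
  assumes "smooth_halfplane u" and "v \<in> partials u" and "t \<ge> 0"
  shows "((\<lambda>y. v y t) has_real_derivative partial_x v x t) (at x)"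
  using assms by (simp add: smooth_halfplane_def partial_x_def DERIV_deriv_iff_real_differentiable)

lemma partials_has_time_derivative:
  assumes "smooth_halfplane u" and "v \<in> partials u" and "t \<ge> 0"
  shows "((\<lambda>s. v x s) has_real_derivative partial_t v x t) (at t within {0..})"
  using assms
  by (simp add: smooth_halfplane_def partial_t_def has_real_derivative_iff_has_vector_derivative
      vector_derivative_works)

text \<open>Schwarz's theorem up to the boundary \<open>t = 0\<close>. In time, differentiate
  \<open>v y t - v a t = \<integral>\<^bsub>a\<^esub>\<^bsup>y\<^esup> v\<^sub>x\<close> under the integral sign to get
  \<open>v\<^sub>t y t - v\<^sub>t a t = \<integral>\<^bsub>a\<^esub>\<^bsup>y\<^esup> v\<^sub>x\<^sub>t\<close>; then differentiate this in \<open>y\<close>.\<close>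

lemma mixed_partials_commute:
  assumes smooth: "smooth_halfplane u" and v: "v \<in> partials u" and t: "t \<ge> 0"
  shows "partial_x (partial_t v) x t = partial_t (partial_x v) x t"
proof -
  define a b where "a = x - 1" and "b = x + 1"
  define vtx where "vtx = partial_t (partial_x v)"
  have vx: "partial_x v \<in> partials u" and vt: "partial_t v \<in> partials u"
    and vtx: "vtx \<in> partials u"
    unfolding vtx_def using v by (auto intro: partials.intros)
  have cont: "continuous_on (UNIV \<times> {0..}) (\<lambda>(x, t). w x t)" if "w \<in> partials u" for w
    using smooth that by (simp add: smooth_halfplane_def)
  have increment: "integral {a..y} (\<lambda>z. partial_x v z s) = v y s - v a s"
    if "a \<le> y" "s \<ge> 0" for y s
  proof (rule integral_unique, rule fundamental_theorem_of_calculus[OF that(1)])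
    fix z
    show "((\<lambda>z. v z s) has_vector_derivative partial_x v z s) (at z within {a..y})"
      using partials_has_space_derivative[OF smooth v that(2), of z]
      by (auto simp: has_real_derivative_iff_has_vector_derivative
          intro: has_vector_derivative_at_within)
  qed
  have time_increment: "integral {a..y} (\<lambda>z. vtx z t) = partial_t v y t - partial_t v a t"
    if y: "a \<le> y" for y
  proof -
    have "((\<lambda>s. integral (cbox a y) (\<lambda>z. partial_x v z s)) has_vector_derivative
        integral (cbox a y) (\<lambda>z. vtx z t)) (at t within {0..})"
    proof (rule leibniz_rule_vector_derivative)
      show "((\<lambda>s. partial_x v z s) has_vector_derivative vtx z s) (at s within {0..})"
        if "s \<in> {0..}" for s z
        using partials_has_time_derivative[OF smooth vx, of s z] that
        by (simp add: vtx_def has_real_derivative_iff_has_vector_derivative)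
      show "(\<lambda>z. partial_x v z s) integrable_on cbox a y" if "s \<in> {0..}" for s
        using continuous_on_space_slice[OF cont[OF vx], of s] that
        by (intro integrable_continuous) (auto intro: continuous_on_subset)
      have "continuous_on ({0..} \<times> cbox a y) (\<lambda>p. case (snd p, fst p) of (z, s) \<Rightarrow> vtx z s)"
        by (rule continuous_on_compose2[OF cont[OF vtx]]) (auto intro!: continuous_intros)
      then show "continuous_on ({0..} \<times> cbox a y) (\<lambda>(s, z). vtx z s)"
        by (simp add: case_prod_unfold)
    qed (use t in auto)
    then have "((\<lambda>s. v y s - v a s) has_vector_derivative
        integral (cbox a y) (\<lambda>z. vtx z t)) (at t within {0..})"
      by (rule has_vector_derivative_transform[rotated 2]) (use t increment[OF y] in auto)
    then have d1: "((\<lambda>s. v y s - v a s) has_vector_derivative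
        integral (cbox a y) (\<lambda>z. vtx z t)) (at t within cbox 0 (t + 1))"
      by (rule has_vector_derivative_within_subset) auto
    have "((\<lambda>s. v y s - v a s) has_real_derivative partial_t v y t - partial_t v a t)
        (at t within {0..})"
      by (intro derivative_intros partials_has_time_derivative[OF smooth v t])
    then have "((\<lambda>s. v y s - v a s) has_vector_derivative
        partial_t v y t - partial_t v a t) (at t within {0..})"
      by (simp add: has_real_derivative_iff_has_vector_derivative)
    then have d2: "((\<lambda>s. v y s - v a s) has_vector_derivative
        partial_t v y t - partial_t v a t) (at t within cbox 0 (t + 1))"
      by (rule has_vector_derivative_within_subset) auto
    show ?thesis
      using vector_derivative_unique_within_closed_interval[OF _ _ d1 d2] t by simp
  qed
  have "((\<lambda>y. integral {a..y} (\<lambda>z. vtx z t)) has_vector_derivative vtx x t) (at x within {a..b})"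
    using continuous_on_space_slice[OF cont[OF vtx] t]
    by (intro integral_has_vector_derivative) (auto simp: a_def b_def intro: continuous_on_subset)
  then have "((\<lambda>y. partial_t v y t - partial_t v a t) has_vector_derivative vtx x t)
      (at x within {a..b})"
    by (rule has_vector_derivative_transform[rotated 2])
       (use time_increment in \<open>auto simp: a_def b_def\<close>)
  moreover have "at x within {a..b} = at x"
    by (rule at_within_Icc_at) (auto simp: a_def b_def)
  ultimately have "((\<lambda>y. partial_t v y t - partial_t v a t) has_real_derivative vtx x t) (at x)"
    by (simp add: has_real_derivative_iff_has_vector_derivative)
  moreover have "((\<lambda>y. partial_t v y t - partial_t v a t) has_real_derivative
      partial_x (partial_t v) x t - 0) (at x)"
    by (intro derivative_intros partials_has_space_derivative[OF smooth vt t])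
  ultimately show ?thesis
    unfolding vtx_def using DERIV_unique by fastforce
qed

section \<open>Lipschitz fluxes\<close>

text \<open>The supremum in \<open>sup_norm\<close> is meaningful only for a bounded function; the Lipschitz constant
  bounds every difference quotient and hence \<open>\<bar>deriv f\<bar>\<close>.\<close>

lemma abs_deriv_le_sup_norm:
  assumes diff: "\<And>x. f differentiable (at x)" and lip: "L-lipschitz_on UNIV f"
  shows "\<bar>deriv f x\<bar> \<le> sup_norm (deriv f)"
proof -
  have "\<bar>deriv f y\<bar> \<le> L" for y
  proof -
    have D: "(f has_real_derivative deriv f y) (at y)"
      using diff by (simp add: DERIV_deriv_iff_real_differentiable)
    then have "((\<lambda>h. \<bar>(f (y + h) - f y) / h\<bar>) \<longlongrightarrow> \<bar>deriv f y\<bar>) (at 0)"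
      unfolding DERIV_def by (rule tendsto_rabs)
    moreover have "\<bar>(f (y + h) - f y) / h\<bar> \<le> L" if "h \<noteq> 0" for h
      using lipschitz_onD[OF lip, of "y + h" y] that
      by (simp add: dist_real_def abs_divide divide_le_eq)
    then have "eventually (\<lambda>h. \<bar>(f (y + h) - f y) / h\<bar> \<le> L) (at 0)"
      by (auto simp: eventually_at_filter)
    ultimately show ?thesis
      by (rule tendsto_upperbound) simp
  qed
  then have "bdd_above (range (\<lambda>x. \<bar>deriv f x\<bar>))" by (intro bdd_aboveI[of _ L]) auto
  then show ?thesis unfolding sup_norm_def by (intro cSUP_upper) auto
qed

lemma abs_increment_le:
  fixes f :: "real \<Rightarrow> real"
  assumes diff: "\<And>x. (f has_real_derivative f' x) (at x)" and bound: "\<And>x. \<bar>f' x\<bar> \<le> M"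
  shows "\<bar>f s - f 0\<bar> \<le> M * \<bar>s\<bar>"
  using field_differentiable_bound[of UNIV f f' M s 0] diff bound by simp

text \<open>The factor \<open>1 / 2\<close>, which the mean value theorem would lose, is what makes the terms of the gradient
  estimate add up to \<open>2 * M\<close>. It comes from monotonicity: both \<open>M / 2 * s\<^sup>2 - F s\<close> and
  \<open>M / 2 * s\<^sup>2 + F s\<close> have a derivative whose sign is weakly that of \<open>s\<close>, so they are minimal at \<open>0\<close>.\<close>

lemma quadratic_primitive_bound:
  fixes F f :: "real \<Rightarrow> real"
  assumes F: "\<And>s. (F has_real_derivative f s) (at s)" and "F 0 = 0"
    and le: "\<And>s. \<bar>f s\<bar> \<le> M * \<bar>s\<bar>"
  shows "\<bar>F s\<bar> \<le> M / 2 * s\<^sup>2"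
proof -
  have *: "c * F s \<le> M / 2 * s\<^sup>2" if c: "\<bar>c\<bar> = 1" for c
  proof -
    let ?G = "\<lambda>s. M / 2 * s\<^sup>2 - c * F s"
    have G: "(?G has_real_derivative M * s - c * f s) (at s)" for s
      by (auto intro!: derivative_eq_intros F)
    have cf: "\<bar>c * f s\<bar> \<le> M * \<bar>s\<bar>" for s using le c by (simp add: abs_mult)
    have "?G 0 \<le> ?G s"
    proof (cases "s \<ge> 0")
      case True
      show ?thesis
      proof (rule DERIV_nonneg_imp_nondecreasing[OF True])
        fix y :: real assume "0 \<le> y"
        then have "M * y - c * f y \<ge> 0" using cf[of y] by auto
        then show "\<exists>z. (?G has_real_derivative z) (at y) \<and> z \<ge> 0" using G by blast
      qed
    next
      case False
      then have "s \<le> 0" by simp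
      then show ?thesis
      proof (rule DERIV_nonpos_imp_nonincreasing)
        fix y :: real assume "y \<le> 0"
        then have "M * y - c * f y \<le> 0" using cf[of y] by auto
        then show "\<exists>z. (?G has_real_derivative z) (at y) \<and> z \<le> 0" using G by blast
      qed
    qed
    then show ?thesis using \<open>F 0 = 0\<close> by simp
  qed
  show ?thesis using *[of 1] *[of "-1"] by simp
qed

lemma exists_primitive:
  fixes f :: "real \<Rightarrow> real"
  assumes "continuous_on UNIV f"
  obtains F where "\<And>s. (F has_real_derivative f s) (at s)" and "F 0 = 0"
proof -
  obtain G where G: "\<And>s. (G has_vector_derivative f s) (at s)"
    using einterval_antiderivative[of "-\<infinity>" "\<infinity>" f] assms
    by (auto simp: continuous_on_eq_continuous_at)
  show thesis
  proof (rule that[of "\<lambda>s. G s - G 0"])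
    show "((\<lambda>s. G s - G 0) has_real_derivative f s) (at s)" for s
      using G[of s] by (auto simp: has_real_derivative_iff_has_vector_derivative[symmetric]
        intro!: derivative_eq_intros)
  qed simp
qed

section \<open>The two balance laws\<close>

locale diffusive_dispersive_solution =
  fixes f :: "real \<Rightarrow> real" and \<epsilon> \<delta> :: real and g :: "real \<Rightarrow> real"
    and u :: "real \<Rightarrow> real \<Rightarrow> real"
  assumes f_smooth: "smooth_real f" and f_lipschitz: "\<exists>L. L-lipschitz_on UNIV f"
    and eps_pos: "\<epsilon> > 0" and delta_nonneg: "\<delta> \<ge> 0"
    and u_smooth: "smooth_halfplane u" and u_decay: "rapidly_decaying u"
    and u_solves: "solves_cauchy_problem f \<epsilon> \<delta> g u"
begin

abbreviation "M \<equiv> sup_norm (deriv f)"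
text \<open>
  The flux is normalised to vanish at \<open>0\<close>, since \<open>f (u x t)\<close> itself tends to \<open>f 0\<close>
  as \<open>\<bar>x\<bar>\<close> grows and so need not decay.
\<close>

abbreviation "flux s \<equiv> f s - f 0"
abbreviation "ux \<equiv> partial_x u"
abbreviation "uxx \<equiv> partial_x ux"
abbreviation "uxxx \<equiv> partial_x uxx"
abbreviation "ut \<equiv> partial_t u"

lemma u_partials:
  "u \<in> partials u" "ux \<in> partials u" "uxx \<in> partials u" "uxxx \<in> partials u" "ut \<in> partials u"
  "partial_t ux \<in> partials u"
  by (auto intro: partials.intros)

lemmas u_decaying = u_partials[THEN slab_decaying_partials[OF u_smooth u_decay]]
lemmas u_space_derivs = u_partials[THEN partials_has_space_derivative[OF u_smooth]]
lemmas u_time_derivs = u_partials[THEN partials_has_time_derivative[OF u_smooth]]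

lemma f_deriv: "(f has_real_derivative deriv f s) (at s)"
  using f_smooth[unfolded smooth_real_def, rule_format, of 0]
  by (simp add: DERIV_deriv_iff_real_differentiable)

lemma deriv_f_le: "\<bar>deriv f s\<bar> \<le> M"
proof -
  obtain L where "L-lipschitz_on UNIV f" using f_lipschitz by blast
  then show ?thesis
    using f_smooth[unfolded smooth_real_def, rule_format, of 0]
    by (intro abs_deriv_le_sup_norm) auto
qed

lemma M_nonneg: "M \<ge> 0"
  using deriv_f_le[of 0] by linarith

lemma flux_le: "\<bar>flux s\<bar> \<le> M * \<bar>s\<bar>"
  by (rule abs_increment_le[OF f_deriv deriv_f_le])

lemma f_continuous: "continuous_on UNIV f" "continuous_on UNIV (deriv f)"
proof -
  show "continuous_on UNIV f"
    using f_deriv by (meson DERIV_continuous_on has_field_derivative_at_within)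
  have "deriv f differentiable (at s)" for s
    using f_smooth[unfolded smooth_real_def, rule_format, of 1] by simp
  then show "continuous_on UNIV (deriv f)"
    by (simp add: differentiable_at_imp_differentiable_on differentiable_imp_continuous_on)
qed

lemma flux_primitive:
  obtains F where "\<And>s. (F has_real_derivative flux s) (at s)" and "F 0 = 0"
    and "\<And>s. \<bar>F s\<bar> \<le> M / 2 * s\<^sup>2"
proof -
  have "continuous_on UNIV (\<lambda>s. flux s)"
    using f_continuous by (auto intro!: continuous_intros)
  then obtain F where F: "\<And>s. (F has_real_derivative flux s) (at s)" and "F 0 = 0"
    by (rule exists_primitive) blast
  with quadratic_primitive_bound[OF F \<open>F 0 = 0\<close> flux_le] that show thesis by blast
qed

lemma continuous_on_comp_u:
  assumes "continuous_on UNIV G"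
  shows "continuous_on (UNIV \<times> {0..}) (\<lambda>(x, t). G (u x t) :: real)"
proof -
  have "continuous_on (UNIV \<times> {0..}) (\<lambda>z. G (case z of (x, t) \<Rightarrow> u x t))"
    by (rule continuous_on_compose2[OF assms slab_decaying_continuous[OF u_decaying(1)]]) auto
  then show ?thesis by (simp add: case_prod_unfold)
qed

lemma flux_decaying: "slab_decaying (\<lambda>x t. flux (u x t))"
  by (rule slab_decaying_dominated[OF u_decaying(1) continuous_on_comp_u flux_le])
     (use f_continuous in \<open>auto intro!: continuous_intros\<close>)

lemma primitive_decaying:
  assumes "\<And>s. (F has_real_derivative flux s) (at s)" and "\<And>s. \<bar>F s\<bar> \<le> M / 2 * s\<^sup>2"
  shows "slab_decaying (\<lambda>x t. F (u x t))"
proof (rule slab_decaying_dominated[OF slab_decaying_square[OF u_decaying(1)] continuous_on_comp_u])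
  show "continuous_on UNIV F"
    using assms(1) by (meson DERIV_continuous_on has_field_derivative_at_within)
  show "\<bar>F (u x t)\<bar> \<le> M / 2 * \<bar>(u x t)\<^sup>2\<bar>" for x t
    using assms(2) by simp
qed

lemma deriv_flux_decaying: "slab_decaying (\<lambda>x t. deriv f (u x t) * (ux x t)\<^sup>2)"
proof (rule slab_decaying_dominated[OF slab_decaying_square[OF u_decaying(2)]])
  show "continuous_on (UNIV \<times> {0..}) (\<lambda>(x, t). deriv f (u x t) * (ux x t)\<^sup>2)"
    using continuous_on_comp_u[OF f_continuous(2)] slab_decaying_continuous[OF u_decaying(2)]
    by (auto simp: case_prod_unfold intro!: continuous_intros)
  show "\<bar>deriv f (u x t) * (ux x t)\<^sup>2\<bar> \<le> M * \<bar>(ux x t)\<^sup>2\<bar>" for x t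
    using deriv_f_le by (auto simp: abs_mult intro!: mult_right_mono)
qed

lemma initial: "u x 0 = g x"
  using u_solves by (simp add: solves_cauchy_problem_def)

lemma equation:
  assumes "t \<ge> 0"
  shows "ut x t = - deriv f (u x t) * ux x t + \<epsilon> * uxx x t + \<delta> * uxxx x t"
proof -
  have "partial_x (\<lambda>y s. f (u y s)) x t = deriv f (u x t) * ux x t"
    unfolding partial_x_def[of "\<lambda>y s. f (u y s)"]
    by (rule DERIV_imp_deriv, rule DERIV_chain2[OF f_deriv u_space_derivs(1)[OF assms]])
  moreover have "ut x t + partial_x (\<lambda>y s. f (u y s)) x t = \<epsilon> * uxx x t + \<delta> * uxxx x t"
    using u_solves assms by (simp add: solves_cauchy_problem_def)
  ultimately show ?thesis by simp
qed

text \<open>Twice \<open>u\<close> times the equation, in divergence form. The term \<open>2 * u * f'(u) * u\<^sub>x\<close> is the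
  \<open>x\<close>-derivative of \<open>2 * (u * flux u - F(u))\<close>, and the dispersion term is that of
  \<open>\<delta> * (2 * u * u\<^sub>x\<^sub>x - u\<^sub>x\<^sup>2)\<close>.\<close>

lemma energy_balance:
  assumes T: "T \<ge> 0"
  shows "(\<integral>x. (u x T)\<^sup>2 \<partial>lborel) + 2 * \<epsilon> * slab_integral T (\<lambda>x t. (ux x t)\<^sup>2)
    = (\<integral>x. (u x 0)\<^sup>2 \<partial>lborel)"
proof -
  obtain F where F: "\<And>s. (F has_real_derivative flux s) (at s)" "F 0 = 0"
    "\<And>s. \<bar>F s\<bar> \<le> M / 2 * s\<^sup>2"
    by (rule flux_primitive) blast
  note Fu = primitive_decaying[OF F(1,3)]
  let ?a = "\<lambda>x t. 2 * (u x t * ut x t)"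
  let ?d = "\<lambda>x t. (2 * \<epsilon>) * (ux x t)\<^sup>2"
  let ?P = "\<lambda>x t. 2 * (F (u x t) - u x t * flux (u x t)) + (2 * \<epsilon>) * (u x t * ux x t)
      + (2 * \<delta>) * (u x t * uxx x t) - \<delta> * (ux x t)\<^sup>2"
  have "(\<integral>x. (u x T)\<^sup>2 \<partial>lborel) + slab_integral T ?d = (\<integral>x. (u x 0)\<^sup>2 \<partial>lborel)"
  proof (rule balance_law_integral[where a = ?a and P = ?P, OF _ _ _ _ _ _ T])
    show "slab_decaying (\<lambda>x t. (u x t)\<^sup>2)" by (intro slab_decaying_square u_decaying)
    show "slab_decaying ?a" by (intro slab_decaying_cmult slab_decaying_mult u_decaying)
    show "slab_decaying ?d" by (intro slab_decaying_cmult slab_decaying_square u_decaying)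
    show "slab_decaying ?P"
      by (rule slab_decaying_add slab_decaying_diff slab_decaying_cmult slab_decaying_square
          u_decaying Fu flux_decaying | rule slab_decaying_mult)+
    fix x t :: real assume t: "t \<ge> 0"
    show "((\<lambda>s. (u x s)\<^sup>2) has_real_derivative ?a x t) (at t within {0..})"
      by (auto intro!: derivative_eq_intros u_time_derivs[OF t])
    note chain = DERIV_chain2[OF F(1) u_space_derivs(1)[OF t]]
      DERIV_chain2[OF f_deriv u_space_derivs(1)[OF t]]
    show "((\<lambda>y. ?P y t) has_real_derivative ?a x t + ?d x t) (at x)"
      unfolding equation[OF t]
      by (rule derivative_eq_intros u_space_derivs[OF t] chain refl)+
         (simp add: algebra_simps power2_eq_square)
  qed
  then show ?thesis by (simp add: slab_integral_cmult)
qed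

text \<open>With \<open>w = \<delta> * u\<^sub>x\<^sub>x - flux u\<close>, the density changes at the rate
  \<open>\<delta> * u\<^sub>x * u\<^sub>x\<^sub>t + flux u * u\<^sub>t = (\<delta> * u\<^sub>x * u\<^sub>t)\<^sub>x - w * u\<^sub>t\<close>, where
  \<open>u\<^sub>x\<^sub>t = u\<^sub>t\<^sub>x\<close> is used. Since \<open>u\<^sub>t = w\<^sub>x + \<epsilon> * u\<^sub>x\<^sub>x\<close>, the last term is
  \<open>- (w\<^sup>2 / 2)\<^sub>x - \<epsilon> * w * u\<^sub>x\<^sub>x\<close>, and the part \<open>\<epsilon> * flux u * u\<^sub>x\<^sub>x\<close> of it equals
  \<open>\<epsilon> * (flux u * u\<^sub>x)\<^sub>x - \<epsilon> * f'(u) * u\<^sub>x\<^sup>2\<close>.\<close>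

lemma dispersive_energy_balance:
  assumes F: "\<And>s. (F has_real_derivative flux s) (at s)" and F_le: "\<And>s. \<bar>F s\<bar> \<le> M / 2 * s\<^sup>2"
    and T: "T \<ge> 0"
  shows "(\<integral>x. \<delta> / 2 * (ux x T)\<^sup>2 + F (u x T) \<partial>lborel)
      + slab_integral T (\<lambda>x t. (\<epsilon> * \<delta>) * (uxx x t)\<^sup>2 + \<epsilon> * (deriv f (u x t) * (ux x t)\<^sup>2))
    = (\<integral>x. \<delta> / 2 * (ux x 0)\<^sup>2 + F (u x 0) \<partial>lborel)"
proof -
  note Fu = primitive_decaying[OF F F_le]
  note decaying = slab_decaying_add slab_decaying_diff slab_decaying_cmult slab_decaying_square
    u_decaying Fu flux_decaying deriv_flux_decaying
  let ?h = "\<lambda>x t. \<delta> / 2 * (ux x t)\<^sup>2 + F (u x t)"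
  let ?a = "\<lambda>x t. \<delta> * (ux x t * partial_t ux x t) + flux (u x t) * ut x t"
  let ?d = "\<lambda>x t. (\<epsilon> * \<delta>) * (uxx x t)\<^sup>2 + \<epsilon> * (deriv f (u x t) * (ux x t)\<^sup>2)"
  let ?P = "\<lambda>x t. \<delta> * (ux x t * ut x t) - 1 / 2 * (\<delta> * uxx x t - flux (u x t))\<^sup>2
      + \<epsilon> * (flux (u x t) * ux x t)"
  show ?thesis
  proof (rule balance_law_integral[where h = ?h and a = ?a and P = ?P, OF _ _ _ _ _ _ T])
    show "slab_decaying ?h" "slab_decaying ?a" "slab_decaying ?d" "slab_decaying ?P"
      by (rule decaying | rule slab_decaying_mult)+
    fix x t :: real assume t: "t \<ge> 0"
    note chain_t = DERIV_chain2[OF F u_time_derivs(1)[OF t]]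
    show "((\<lambda>s. ?h x s) has_real_derivative ?a x t) (at t within {0..})"
      by (rule derivative_eq_intros u_time_derivs[OF t] chain_t refl)+ simp
    note chain = DERIV_chain2[OF f_deriv u_space_derivs(1)[OF t]]
    have "((\<lambda>y. ut y t) has_real_derivative partial_t ux x t) (at x)"
      using u_space_derivs(5)[OF t, of x] mixed_partials_commute[OF u_smooth u_partials(1) t]
      by simp
    then have "((\<lambda>y. ?P y t) has_real_derivative
        \<delta> * (uxx x t * ut x t + ux x t * partial_t ux x t)
        - (\<delta> * uxx x t - flux (u x t)) * (\<delta> * uxxx x t - deriv f (u x t) * ux x t)
        + \<epsilon> * (deriv f (u x t) * ux x t * ux x t + flux (u x t) * uxx x t)) (at x)"
      by (auto intro!: derivative_eq_intros u_space_derivs[OF t] chain simp: field_simps)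
    moreover have "\<delta> * uxxx x t - deriv f (u x t) * ux x t = ut x t - \<epsilon> * uxx x t"
      using equation[OF t] by simp
    ultimately have "((\<lambda>y. ?P y t) has_real_derivative
        \<delta> * (uxx x t * ut x t + ux x t * partial_t ux x t)
        - (\<delta> * uxx x t - flux (u x t)) * (ut x t - \<epsilon> * uxx x t)
        + \<epsilon> * (deriv f (u x t) * ux x t * ux x t + flux (u x t) * uxx x t)) (at x)"
      by (simp only:)
    then show "((\<lambda>y. ?P y t) has_real_derivative ?a x t + ?d x t) (at x)"
      by (rule DERIV_cong) (simp add: algebra_simps power2_eq_square)
  qed
qed

text \<open>In the second balance law, \<open>\<integral>F(u(T))\<close> and the integral of \<open>\<epsilon> * f'(u) * u\<^sub>x\<^sup>2\<close> have no sign.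
  Together they are at most \<open>M / 2\<close> times the left-hand side of \<open>energy_balance\<close>, that is,
  \<open>M / 2 * \<integral>u\<^sup>2(0)\<close>; the initial term \<open>\<integral>F(u(0))\<close> accounts for the same amount once more.\<close>

lemma gradient_estimate:
  assumes T: "T \<ge> 0"
  shows "\<delta> * (\<integral>x. (ux x T)\<^sup>2 \<partial>lborel) + 2 * (\<epsilon> * \<delta>) * slab_integral T (\<lambda>x t. (uxx x t)\<^sup>2)
    \<le> 2 * M * (\<integral>x. (u x 0)\<^sup>2 \<partial>lborel) + \<delta> * (\<integral>x. (ux x 0)\<^sup>2 \<partial>lborel)"
proof -
  obtain F where F: "\<And>s. (F has_real_derivative flux s) (at s)" "F 0 = 0"
    "\<And>s. \<bar>F s\<bar> \<le> M / 2 * s\<^sup>2"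
    by (rule flux_primitive) blast
  note Fu = primitive_decaying[OF F(1,3)]
  let ?E = "\<lambda>t. \<integral>x. (u x t)\<^sup>2 \<partial>lborel" and ?X = "\<lambda>t. \<integral>x. (ux x t)\<^sup>2 \<partial>lborel"
  let ?V = "\<lambda>t. \<integral>x. F (u x t) \<partial>lborel"
  let ?I1 = "slab_integral T (\<lambda>x t. (ux x t)\<^sup>2)" and ?I2 = "slab_integral T (\<lambda>x t. (uxx x t)\<^sup>2)"
  let ?J = "slab_integral T (\<lambda>x t. deriv f (u x t) * (ux x t)\<^sup>2)"
  have sq: "slab_decaying (\<lambda>x t. (v x t)\<^sup>2)" if "v \<in> {u, ux, uxx}" for v
    using that u_decaying by (auto intro: slab_decaying_square)
  have H: "(\<integral>x. \<delta> / 2 * (ux x t)\<^sup>2 + F (u x t) \<partial>lborel) = \<delta> / 2 * ?X t + ?V t"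
    if "t \<ge> 0" for t
    using Bochner_Integration.integral_add[OF
        slab_decaying_integrable[OF slab_decaying_cmult[OF sq[of ux], of "\<delta> / 2"] that]
        slab_decaying_integrable[OF Fu that]]
    by simp
  have D: "slab_integral T (\<lambda>x t. (\<epsilon> * \<delta>) * (uxx x t)\<^sup>2 + \<epsilon> * (deriv f (u x t) * (ux x t)\<^sup>2))
      = \<epsilon> * \<delta> * ?I2 + \<epsilon> * ?J"
    using sq deriv_flux_decaying
    by (subst slab_integral_add) (auto intro: slab_decaying_cmult simp: slab_integral_cmult)
  have V: "\<bar>?V t\<bar> \<le> M / 2 * ?E t" if "t \<ge> 0" for t
  proof -
    have "\<bar>?V t\<bar> \<le> (\<integral>x. \<bar>F (u x t)\<bar> \<partial>lborel)" by (rule integral_abs_bound)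
    also have "\<dots> \<le> (\<integral>x. M / 2 * (u x t)\<^sup>2 \<partial>lborel)"
      using that sq Fu F(3)
      by (intro integral_mono integrable_abs integrable_mult_right) (auto intro: slab_decaying_integrable)
    finally show ?thesis by simp
  qed
  have J: "- M * ?I1 \<le> ?J"
  proof -
    have "slab_integral T (\<lambda>x t. - M * (ux x t)\<^sup>2) \<le> ?J"
    proof (rule slab_integral_mono[OF slab_decaying_cmult[OF sq] deriv_flux_decaying])
      show "- M * (ux x t)\<^sup>2 \<le> deriv f (u x t) * (ux x t)\<^sup>2" for x t
        using deriv_f_le[of "u x t"] by (intro mult_right_mono) auto
    qed simp
    then show ?thesis by (simp only: slab_integral_cmult)
  qed
  have B: "\<delta> / 2 * ?X T + ?V T + (\<epsilon> * \<delta> * ?I2 + \<epsilon> * ?J) = \<delta> / 2 * ?X 0 + ?V 0"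
    using dispersive_energy_balance[OF F(1,3) T] H[OF T] H[of 0] D by simp
  \<comment> \<open>multiplied by \<open>M / 2\<close> so that its two terms match the bounds on \<open>?V T\<close> and \<open>\<epsilon> * ?J\<close>\<close>
  have "M / 2 * (?E T + 2 * \<epsilon> * ?I1) = M / 2 * ?E 0"
    using energy_balance[OF T] by simp
  moreover have "\<epsilon> * (- M * ?I1) \<le> \<epsilon> * ?J"
    using J eps_pos by (intro mult_left_mono) auto
  ultimately show ?thesis
    using B V[OF T] V[of 0] unfolding abs_le_iff by (simp add: algebra_simps)
qed

section \<open>The norm estimates\<close>

lemma slab_dissipation_le:
  assumes T: "T \<ge> 0"
  shows "2 * \<epsilon> * slab_integral T (\<lambda>x t. (ux x t)\<^sup>2) \<le> (\<integral>x. (u x 0)\<^sup>2 \<partial>lborel)"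
proof -
  have "(\<integral>x. (u x T)\<^sup>2 \<partial>lborel) \<ge> 0" by simp
  with energy_balance[OF T] show ?thesis by linarith
qed

lemma initial_L2_norms:
  "L2_norm g = ennreal (sqrt (\<integral>x. (u x 0)\<^sup>2 \<partial>lborel))"
  "L2_norm (deriv g) = ennreal (sqrt (\<integral>x. (ux x 0)\<^sup>2 \<partial>lborel))"
proof -
  have g: "g = (\<lambda>x. u x 0)" using initial by auto
  have g': "deriv g = (\<lambda>x. ux x 0)" by (simp add: g partial_x_def)
  show "L2_norm g = ennreal (sqrt (\<integral>x. (u x 0)\<^sup>2 \<partial>lborel))"
    unfolding g by (rule L2_norm_slice[OF u_decaying(1)]) simp
  show "L2_norm (deriv g) = ennreal (sqrt (\<integral>x. (ux x 0)\<^sup>2 \<partial>lborel))"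
    unfolding g' by (rule L2_norm_slice[OF u_decaying(2)]) simp
qed

lemma L2_norm_u_le:
  assumes t: "t \<ge> 0"
  shows "L2_norm (\<lambda>x. u x t) \<le> L2_norm g"
proof -
  have "2 * \<epsilon> * slab_integral t (\<lambda>x t. (ux x t)\<^sup>2) \<ge> 0"
    using eps_pos by (intro mult_nonneg_nonneg slab_integral_nonneg) auto
  with energy_balance[OF t] have "(\<integral>x. (u x t)\<^sup>2 \<partial>lborel) \<le> (\<integral>x. (u x 0)\<^sup>2 \<partial>lborel)"
    by linarith
  then show ?thesis
    unfolding initial_L2_norms L2_norm_slice[OF u_decaying(1) t] by (intro ennreal_leI) simp
qed

lemma L2_time_norm_ux_le:
  "ennreal (sqrt (2 * \<epsilon>)) * L2_time_norm ux \<le> L2_norm g"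
proof -
  let ?A = "\<integral>x. (u x 0)\<^sup>2 \<partial>lborel"
  have "L2_time_norm ux \<le> ennreal (sqrt (?A / (2 * \<epsilon>)))"
    using slab_dissipation_le eps_pos
    by (intro L2_time_norm_le u_decaying) (simp add: pos_le_divide_eq mult.commute)
  then have "ennreal (sqrt (2 * \<epsilon>)) * L2_time_norm ux
      \<le> ennreal (sqrt (2 * \<epsilon>)) * ennreal (sqrt (?A / (2 * \<epsilon>)))"
    by (rule mult_left_mono) simp
  also have "\<dots> = ennreal (sqrt ?A)"
    using eps_pos by (simp add: ennreal_mult[symmetric] real_sqrt_mult[symmetric])
  finally show ?thesis by (simp only: initial_L2_norms)
qed

text \<open>The right-hand side of \<open>gradient_estimate\<close> has two nonnegative terms, and the square root is
  subadditive.\<close>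

lemma sqrt_gradient_bound_le:
  "ennreal (sqrt (2 * M * (\<integral>x. (u x 0)\<^sup>2 \<partial>lborel) + \<delta> * (\<integral>x. (ux x 0)\<^sup>2 \<partial>lborel)))
    \<le> ennreal (sqrt (2 * M)) * L2_norm g + ennreal (sqrt \<delta>) * L2_norm (deriv g)"
proof -
  let ?A = "\<integral>x. (u x 0)\<^sup>2 \<partial>lborel" and ?B = "\<integral>x. (ux x 0)\<^sup>2 \<partial>lborel"
  have "sqrt (2 * M * ?A + \<delta> * ?B) \<le> sqrt (2 * M * ?A) + sqrt (\<delta> * ?B)"
    using M_nonneg delta_nonneg by (intro sqrt_add_le_add_sqrt) auto
  also have "\<dots> = sqrt (2 * M) * sqrt ?A + sqrt \<delta> * sqrt ?B"
    by (simp only: real_sqrt_mult)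
  finally have "ennreal (sqrt (2 * M * ?A + \<delta> * ?B))
      \<le> ennreal (sqrt (2 * M) * sqrt ?A + sqrt \<delta> * sqrt ?B)"
    by (rule ennreal_leI)
  also have "\<dots> = ennreal (sqrt (2 * M)) * L2_norm g + ennreal (sqrt \<delta>) * L2_norm (deriv g)"
    unfolding initial_L2_norms using M_nonneg delta_nonneg
    by (subst ennreal_plus) (simp_all add: ennreal_mult del: real_sqrt_mult)
  finally show ?thesis .
qed

lemma L2_norm_ux_le:
  assumes t: "t \<ge> 0"
  shows "ennreal (sqrt \<delta>) * L2_norm (\<lambda>x. ux x t)
    \<le> ennreal (sqrt (2 * M)) * L2_norm g + ennreal (sqrt \<delta>) * L2_norm (deriv g)"
proof -
  let ?K = "2 * M * (\<integral>x. (u x 0)\<^sup>2 \<partial>lborel) + \<delta> * (\<integral>x. (ux x 0)\<^sup>2 \<partial>lborel)"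
  have "2 * (\<epsilon> * \<delta>) * slab_integral t (\<lambda>x t. (uxx x t)\<^sup>2) \<ge> 0"
    using eps_pos delta_nonneg by (intro mult_nonneg_nonneg slab_integral_nonneg) auto
  with gradient_estimate[OF t] have "\<delta> * (\<integral>x. (ux x t)\<^sup>2 \<partial>lborel) \<le> ?K"
    by linarith
  then have "ennreal (sqrt (\<delta> * (\<integral>x. (ux x t)\<^sup>2 \<partial>lborel))) \<le> ennreal (sqrt ?K)"
    by (intro ennreal_leI) simp
  also note sqrt_gradient_bound_le
  finally show ?thesis
    unfolding L2_norm_slice[OF u_decaying(2) t] real_sqrt_mult using delta_nonneg
    by (subst ennreal_mult[symmetric]) simp_all
qed

lemma L2_time_norm_uxx_le:
  "ennreal (sqrt (\<epsilon> * \<delta>)) * L2_time_norm uxx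
    \<le> ennreal (sqrt (2 * M)) * L2_norm g + ennreal (sqrt \<delta>) * L2_norm (deriv g)"
proof (cases "\<delta> = 0")
  case False
  then have pos: "\<epsilon> * \<delta> > 0" using eps_pos delta_nonneg by simp
  let ?K = "2 * M * (\<integral>x. (u x 0)\<^sup>2 \<partial>lborel) + \<delta> * (\<integral>x. (ux x 0)\<^sup>2 \<partial>lborel)"
  have "slab_integral T (\<lambda>x t. (uxx x t)\<^sup>2) \<le> ?K / (\<epsilon> * \<delta>)" if T: "T \<ge> 0" for T
  proof -
    have "\<delta> * (\<integral>x. (ux x T)\<^sup>2 \<partial>lborel) \<ge> 0" using delta_nonneg by simp
    moreover have "\<epsilon> * \<delta> * slab_integral T (\<lambda>x t. (uxx x t)\<^sup>2) \<ge> 0"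
      using eps_pos delta_nonneg by (intro mult_nonneg_nonneg slab_integral_nonneg) auto
    ultimately have "\<epsilon> * \<delta> * slab_integral T (\<lambda>x t. (uxx x t)\<^sup>2) \<le> ?K"
      using gradient_estimate[OF T] by linarith
    then show ?thesis using pos by (simp add: pos_le_divide_eq mult.commute)
  qed
  then have "L2_time_norm uxx \<le> ennreal (sqrt (?K / (\<epsilon> * \<delta>)))"
    by (intro L2_time_norm_le u_decaying)
  then have "ennreal (sqrt (\<epsilon> * \<delta>)) * L2_time_norm uxx
      \<le> ennreal (sqrt (\<epsilon> * \<delta>)) * ennreal (sqrt (?K / (\<epsilon> * \<delta>)))"
    by (rule mult_left_mono) simp
  also have "\<dots> = ennreal (sqrt (\<epsilon> * \<delta>) * sqrt (?K / (\<epsilon> * \<delta>)))"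
    using eps_pos M_nonneg delta_nonneg by (intro ennreal_mult[symmetric]) auto
  also have "sqrt (\<epsilon> * \<delta>) * sqrt (?K / (\<epsilon> * \<delta>)) = sqrt ?K"
    using eps_pos False by (subst real_sqrt_mult[symmetric]) simp
  also note sqrt_gradient_bound_le
  finally show ?thesis .
qed simp

end

theorem theorem2p1:
  fixes f u0 :: "real \<Rightarrow> real"
    and \<delta> :: "real \<Rightarrow> real"
    and u0e :: "real \<Rightarrow> real \<Rightarrow> real"
    and u :: "real \<Rightarrow> real \<Rightarrow> real \<Rightarrow> real"
  assumes f_smooth: "smooth_real f"
    and f_lipschitz: "\<exists>L. L-lipschitz_on UNIV f"
    and u0_L2: "u0 \<in> L2_space"
    and delta_nonneg: "\<And>\<epsilon>. \<epsilon> > 0 \<Longrightarrow> \<delta> \<epsilon> \<ge> 0"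
    and delta_tendsto: "(\<delta> \<longlongrightarrow> 0) (at_right 0)"
    and u0e_weak: "weakly_tendsto_L2 u0e u0 (at_right 0)"
    and u_smooth: "\<And>\<epsilon>. \<epsilon> > 0 \<Longrightarrow> smooth_halfplane (u \<epsilon>)"
    and u_decay: "\<And>\<epsilon>. \<epsilon> > 0 \<Longrightarrow> rapidly_decaying (u \<epsilon>)"
    and u_solves: "\<And>\<epsilon>. \<epsilon> > 0 \<Longrightarrow> solves_cauchy_problem f \<epsilon> (\<delta> \<epsilon>) (u0e \<epsilon>) (u \<epsilon>)"
  shows "\<forall>\<epsilon>>0.
    (\<forall>t\<ge>0. L2_norm (\<lambda>x. u \<epsilon> x t) \<le> L2_norm (u0e \<epsilon>)) \<and>
    ennreal (sqrt (2 * \<epsilon>)) * L2_time_norm (partial_x (u \<epsilon>)) \<le> L2_norm (u0e \<epsilon>) \<and>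
    (\<forall>t\<ge>0. ennreal (sqrt (\<delta> \<epsilon>)) * L2_norm (\<lambda>x. partial_x (u \<epsilon>) x t)
       \<le> ennreal (sqrt (2 * sup_norm (deriv f))) * L2_norm (u0e \<epsilon>)
         + ennreal (sqrt (\<delta> \<epsilon>)) * L2_norm (deriv (u0e \<epsilon>))) \<and>
    ennreal (sqrt (\<epsilon> * \<delta> \<epsilon>)) * L2_time_norm (partial_x (partial_x (u \<epsilon>)))
       \<le> ennreal (sqrt (2 * sup_norm (deriv f))) * L2_norm (u0e \<epsilon>)
         + ennreal (sqrt (\<delta> \<epsilon>)) * L2_norm (deriv (u0e \<epsilon>))"
proof (intro allI impI)
  fix \<epsilon> :: real assume eps: "\<epsilon> > 0"
  interpret diffusive_dispersive_solution f \<epsilon> "\<delta> \<epsilon>" "u0e \<epsilon>" "u \<epsilon>"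
    by unfold_locales (use assms eps in auto)
  show "(\<forall>t\<ge>0. L2_norm (\<lambda>x. u \<epsilon> x t) \<le> L2_norm (u0e \<epsilon>)) \<and>
    ennreal (sqrt (2 * \<epsilon>)) * L2_time_norm (partial_x (u \<epsilon>)) \<le> L2_norm (u0e \<epsilon>) \<and>
    (\<forall>t\<ge>0. ennreal (sqrt (\<delta> \<epsilon>)) * L2_norm (\<lambda>x. partial_x (u \<epsilon>) x t)
       \<le> ennreal (sqrt (2 * sup_norm (deriv f))) * L2_norm (u0e \<epsilon>)
         + ennreal (sqrt (\<delta> \<epsilon>)) * L2_norm (deriv (u0e \<epsilon>))) \<and>
    ennreal (sqrt (\<epsilon> * \<delta> \<epsilon>)) * L2_time_norm (partial_x (partial_x (u \<epsilon>)))
       \<le> ennreal (sqrt (2 * sup_norm (deriv f))) * L2_norm (u0e \<epsilon>)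
         + ennreal (sqrt (\<delta> \<epsilon>)) * L2_norm (deriv (u0e \<epsilon>))"
    using L2_norm_u_le L2_time_norm_ux_le L2_norm_ux_le L2_time_norm_uxx_le by blast
qed

end
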